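(* Let $Q\in\mathbb{R}^{n\times n}$ be symmetric positive definite and $Z\subseteq\{0,1\}^n$. Suppose that a minimal description of the polytope $P$ (in variables $(z,W)\in\mathbb{R}^n\times\mathbb{R}^{n\times n}$) is given by the facet-defining inequalities $$\langle\Gamma_i,W\rangle-\gamma_i^\top z\le\beta_i,\quad i=1,\dots,m_1,$$ and the equalities $$\langle\Gamma_i,W\rangle-\gamma_i^\top z=\beta_i,\quad i=m_1+1,\dots,m,$$ where $\Gamma_i\in\mathbb{R}^{n\times n}$, $\gamma_i\in\mathbb{R}^n$, $\beta_i\in\mathbb{R}$. Let $$\mathcal{Y}=\left\{y\in\mathbb{R}_+^{m_1}\times\mathbb{R}^{m-m_1}:\ \sum_{i=1}^m\Gamma_iy_i\succeq 0,\ \sum_{i=1}^m\operatorname{Tr}(\Gamma_i)y_i\le 1\right\}.$$ Then a point $(x,z,t)\in\mathbb{R}^n\times\mathbb{R}^n\times\mathbb{R}$ belongs to $\operatorname{cl\,conv}(X)$ if and only if $z\in\operatorname{conv}(Z)$, $t\ge 0$ and $$t\ \ge\ \frac{x^\top\left(\sum_{i=1}^m\Gamma_iy_i\right)x}{y^\top\beta+\left(\sum_{i=1}^my_i\gamma_i\right)^\top z}\qquad\text{for all }y\in\mathcal{Y},$$ or, equivalently, if and only if $z\in\operatorname{conv}(Z)$, $t\ge0$ and $$t\ \ge\ \sup_{y\in\mathcal{Y}}\ \frac{x^\top\left(\sum_{i=1}^m\Gamma_iy_i\right)x}{y^\top\beta+\left(\sum_{i=1}^my_i\gamma_i\right)^\top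 z}.$$
   Context: $\operatorname{cl\,conv}$ denotes the closure of the convex hull. Let $\mathbf{e}$ be the all-ones vector in $\mathbb{R}^n$ and $\circ$ the Hadamard (entrywise) product. Set $$X=\{(x,z,t)\in\mathbb{R}^n\times Z\times\mathbb{R}: t\ge x^\top Qx,\ x\circ(\mathbf{e}-z)=0\}.$$ For $S\subseteq[n]=\{1,\dots,n\}$, $\hat{\mathbf{e}}_S\in\{0,1\}^n$ is the indicator vector of $S$, $Q_S$ is the principal submatrix of $Q$ indexed by $S$, and $\hat Q_S^{-1}\in\mathbb{R}^{n\times n}$ is the matrix whose submatrix indexed by $S$ equals $Q_S^{-1}$ and whose other entries are all zero. The polytope $P\subseteq\mathbb{R}^{n+n^2}$ is $$P=\operatorname{conv}\{(\hat{\mathbf{e}}_S,\hat Q_S^{-1}): \hat{\mathbf{e}}_S\in Z\}.$$ $\langle V,W\rangle=\sum_{i,j}V_{ij}W_{ij}$ is the usual matrix inner product, $\beta=(\beta_1,\dots,\beta_m)$, $\mathbb{R}_+$ is the set of nonnegative reals, and $M\succeq 0$ means that $M$ is symmetric positive semidefinite. Convention for fractions: $0/0=0$ and $c/0=+\infty$ for $c>0$. *)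

theory Defs
  imports "HOL-Analysis.Analysis"
begin

definition pos_def :: "real^'n^'n \<Rightarrow> bool" where
  "pos_def M \<longleftrightarrow> transpose M = M \<and> (\<forall>x. x \<noteq> 0 \<longrightarrow> 0 < x \<bullet> (M *v x))"

definition pos_semidef :: "real^'n^'n \<Rightarrow> bool" where
  "pos_semidef M \<longleftrightarrow> transpose M = M \<and> (\<forall>x. 0 \<le> x \<bullet> (M *v x))"

text \<open>On vectors, \<open>*\<close> and \<open>1\<close> are the entrywise product and the all-ones vector.\<close>

definition X_set :: "real^'n^'n \<Rightarrow> (real^'n) set \<Rightarrow> ((real^'n) \<times> (real^'n) \<times> real) set" where
  "X_set Q Z = {(x, z, t). z \<in> Z \<and> t \<ge> x \<bullet> (Q *v x) \<and> x * (1 - z) = 0}"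

definition ind_vec :: "'n set \<Rightarrow> real^'n" where
  "ind_vec S = (\<chi> i. if i \<in> S then 1 else 0)"

text \<open>The \<open>S \<times> S\<close> submatrices of \<open>A\<close> and \<open>B\<close> are inverse to each other.\<close>

definition inverse_on :: "'n set \<Rightarrow> real^'n^'n \<Rightarrow> real^'n^'n \<Rightarrow> bool" where
  "inverse_on S A B \<longleftrightarrow> (\<forall>i\<in>S. \<forall>j\<in>S.
     (\<Sum>k\<in>S. A $ i $ k * B $ k $ j) = (if i = j then 1 else 0) \<and>
     (\<Sum>k\<in>S. B $ i $ k * A $ k $ j) = (if i = j then 1 else 0))"

definition padded_inverse :: "real^'n^'n \<Rightarrow> 'n set \<Rightarrow> real^'n^'n" where
  "padded_inverse Q S =
     (THE W. inverse_on S Q W \<and> (\<forall>i j. i \<notin> S \<or> j \<notin> S \<longrightarrow> W $ i $ j = 0))"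

definition P_polytope :: "real^'n^'n \<Rightarrow> (real^'n) set \<Rightarrow> ((real^'n) \<times> (real^'n^'n)) set" where
  "P_polytope Q Z = convex hull {(ind_vec S, padded_inverse Q S) | S. ind_vec S \<in> Z}"

text \<open>The definite description in \<open>padded_inverse\<close> is well defined: a positive definite
  matrix has invertible principal submatrices.\<close>

lemma inverse_on_unique:
  fixes A B C :: "real^'n^'n"
  assumes "inverse_on S A B" "inverse_on S A C" "i \<in> S" "j \<in> S"
  shows "B $ i $ j = C $ i $ j"
proof -
  have "B $ i $ j = (\<Sum>k\<in>S. B $ i $ k * (if k = j then 1 else 0))"
    using assms(4) by (simp add: if_distrib[of "\<lambda>a. _ * a"] cong: if_cong)
  also have "\<dots> = (\<Sum>k\<in>S. B $ i $ k * (\<Sum>l\<in>S. A $ k $ l * C $ l $ j))"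
    using assms by (intro sum.cong) (auto simp: inverse_on_def)
  also have "\<dots> = (\<Sum>l\<in>S. (\<Sum>k\<in>S. B $ i $ k * A $ k $ l) * C $ l $ j)"
    unfolding sum_distrib_left sum_distrib_right
    by (subst sum.swap) (simp add: mult.assoc)
  also have "\<dots> = (\<Sum>l\<in>S. (if i = l then 1 else 0) * C $ l $ j)"
    using assms by (intro sum.cong) (auto simp: inverse_on_def)
  also have "\<dots> = C $ i $ j"
    using assms(3) by (simp add: if_distrib[of "\<lambda>a. a * _"] cong: if_cong)
  finally show ?thesis .
qed

lemma inverse_on_exists:
  fixes Q :: "real^'n^'n"
  assumes "pos_def Q"
  shows "\<exists>W. inverse_on S Q W \<and> (\<forall>i j. i \<notin> S \<or> j \<notin> S \<longrightarrow> W $ i $ j = 0)"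
proof -
  define M :: "real^'n^'n" where
    "M = (\<chi> i j. if i \<in> S \<and> j \<in> S then Q $ i $ j else if i = j then 1 else 0)"
  have "x = 0" if Mx: "M *v x = 0" for x :: "real^'n"
  proof -
    have out: "x $ i = 0" if "i \<notin> S" for i
    proof -
      have "(M *v x) $ i = x $ i"
        using that by (simp add: M_def matrix_vector_mult_def if_distrib[of "\<lambda>a. a * _"] cong: if_cong)
      then show ?thesis using Mx by simp
    qed
    have row: "(Q *v x) $ i = 0" if "i \<in> S" for i
    proof -
      have "(M *v x) $ i = (Q *v x) $ i"
        unfolding matrix_vector_mult_def vec_lambda_beta
        using that out by (intro sum.cong) (auto simp: M_def)
      then show ?thesis using Mx by simp
    qed
    have "x \<bullet> (Q *v x) = (\<Sum>i\<in>UNIV. x $ i * (Q *v x) $ i)"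
      by (simp add: inner_vec_def)
    also have "\<dots> = 0"
    proof (intro sum.neutral ballI)
      fix i
      show "x $ i * (Q *v x) $ i = 0"
        using out[of i] row[of i] by (cases "i \<in> S") simp_all
    qed
    finally show "x = 0"
      using assms unfolding pos_def_def by force
  qed
  then have "\<exists>N. N ** M = mat 1"
    using matrix_left_invertible_ker by blast
  then obtain N where NM: "N ** M = mat 1" by blast
  then have MN: "M ** N = mat 1"
    by (simp add: matrix_left_right_inverse)
  define W :: "real^'n^'n" where "W = (\<chi> i j. if i \<in> S \<and> j \<in> S then N $ i $ j else 0)"
  have "inverse_on S Q W"
    unfolding inverse_on_def
  proof (intro ballI conjI)
    fix i j assume ij: "i \<in> S" "j \<in> S"
    have "(\<Sum>k\<in>S. Q $ i $ k * W $ k $ j) = (\<Sum>k\<in>UNIV. M $ i $ k * N $ k $ j)"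
      using ij by (intro sum.mono_neutral_cong_left) (auto simp: M_def W_def)
    also have "\<dots> = (M ** N) $ i $ j" by (simp add: matrix_matrix_mult_def)
    finally show "(\<Sum>k\<in>S. Q $ i $ k * W $ k $ j) = (if i = j then 1 else 0)"
      by (simp add: MN mat_def)
    have "(\<Sum>k\<in>S. W $ i $ k * Q $ k $ j) = (\<Sum>k\<in>UNIV. N $ i $ k * M $ k $ j)"
      using ij by (intro sum.mono_neutral_cong_left) (auto simp: M_def W_def)
    also have "\<dots> = (N ** M) $ i $ j" by (simp add: matrix_matrix_mult_def)
    finally show "(\<Sum>k\<in>S. W $ i $ k * Q $ k $ j) = (if i = j then 1 else 0)"
      by (simp add: NM mat_def)
  qed
  then show ?thesis by (intro exI[of _ W]) (auto simp: W_def)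
qed

lemma padded_inverse:
  fixes Q :: "real^'n^'n"
  assumes "pos_def Q"
  shows "inverse_on S Q (padded_inverse Q S)"
    and "i \<notin> S \<or> j \<notin> S \<Longrightarrow> padded_inverse Q S $ i $ j = 0"
proof -
  let ?R = "\<lambda>W. inverse_on S Q W \<and> (\<forall>i j. i \<notin> S \<or> j \<notin> S \<longrightarrow> W $ i $ j = 0)"
  obtain W where W: "?R W" using inverse_on_exists[OF assms] by blast
  have "V = W" if "?R V" for V
  proof -
    have "V $ i $ j = W $ i $ j" for i j
      using that W inverse_on_unique[of S Q V W i j] by (cases "i \<in> S \<and> j \<in> S") auto
    then show ?thesis by (simp add: vec_eq_iff)
  qed
  with W have "?R (padded_inverse Q S)"
    unfolding padded_inverse_def by (rule theI)
  then show "inverse_on S Q (padded_inverse Q S)"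
    and "i \<notin> S \<or> j \<notin> S \<Longrightarrow> padded_inverse Q S $ i $ j = 0" by blast+
qed

text \<open>\<open>\<Gamma> \<bullet> W\<close> is the entrywise inner product of matrices.  Constraint \<open>i\<close> is an inequality
  for \<open>i \<le> m1\<close> and an equality for \<open>i > m1\<close>.\<close>

definition solution_set ::
  "nat \<Rightarrow> nat set \<Rightarrow> (nat \<Rightarrow> real^'n^'n) \<Rightarrow> (nat \<Rightarrow> real^'n) \<Rightarrow> (nat \<Rightarrow> real)
     \<Rightarrow> ((real^'n) \<times> (real^'n^'n)) set" where
  "solution_set m1 I \<Gamma> \<gamma> \<beta> = {(z, W). \<forall>i\<in>I.
     (if i \<le> m1 then \<Gamma> i \<bullet> W - \<gamma> i \<bullet> z \<le> \<beta> i else \<Gamma> i \<bullet> W - \<gamma> i \<bullet> z = \<beta> i)}"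

definition facet_defining ::
  "((real^'n) \<times> (real^'n^'n)) set \<Rightarrow> real^'n^'n \<Rightarrow> real^'n \<Rightarrow> real \<Rightarrow> bool" where
  "facet_defining P G g b \<longleftrightarrow>
     (\<forall>(z, W)\<in>P. G \<bullet> W - g \<bullet> z \<le> b) \<and>
     {(z, W) \<in> P. G \<bullet> W - g \<bullet> z = b} facet_of P"

text \<open>Minimal: no constraint can be dropped.  For facet-defining inequalities this says that
  distinct inequalities define distinct facets and that the equalities are linearly
  independent.\<close>

definition minimal_description ::
  "((real^'n) \<times> (real^'n^'n)) set \<Rightarrow> nat \<Rightarrow> nat \<Rightarrow> (nat \<Rightarrow> real^'n^'n) \<Rightarrow> (nat \<Rightarrow> real^'n)
     \<Rightarrow> (nat \<Rightarrow> real) \<Rightarrow> bool" where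
  "minimal_description P m1 m \<Gamma> \<gamma> \<beta> \<longleftrightarrow>
     m1 \<le> m \<and>
     P = solution_set m1 {1..m} \<Gamma> \<gamma> \<beta> \<and>
     (\<forall>i\<in>{1..m1}. facet_defining P (\<Gamma> i) (\<gamma> i) (\<beta> i)) \<and>
     (\<forall>j\<in>{1..m}. solution_set m1 ({1..m} - {j}) \<Gamma> \<gamma> \<beta> \<noteq> P)"

text \<open>Vectors indexed by \<open>1..m\<close> are functions fixed to \<open>undefined\<close> outside \<open>{1..m}\<close>.\<close>

definition Y_set :: "nat \<Rightarrow> nat \<Rightarrow> (nat \<Rightarrow> real^'n^'n) \<Rightarrow> (nat \<Rightarrow> real) set" where
  "Y_set m1 m \<Gamma> = {y \<in> extensional {1..m}.
     (\<forall>i\<in>{1..m1}. 0 \<le> y i) \<and>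
     pos_semidef (\<Sum>i=1..m. y i *\<^sub>R \<Gamma> i) \<and>
     (\<Sum>i=1..m. trace (\<Gamma> i) * y i) \<le> 1}"

text \<open>Division in \<open>ereal\<close> satisfies \<open>0/0 = 0\<close> and \<open>c/0 = \<infinity>\<close> for \<open>c > 0\<close>.\<close>

definition ratio ::
  "nat \<Rightarrow> (nat \<Rightarrow> real^'n^'n) \<Rightarrow> (nat \<Rightarrow> real^'n) \<Rightarrow> (nat \<Rightarrow> real)
     \<Rightarrow> real^'n \<Rightarrow> real^'n \<Rightarrow> (nat \<Rightarrow> real) \<Rightarrow> ereal" where
  "ratio m \<Gamma> \<gamma> \<beta> x z y =
     ereal (x \<bullet> ((\<Sum>i=1..m. y i *\<^sub>R \<Gamma> i) *v x)) /
     ereal ((\<Sum>i=1..m. y i * \<beta> i) + (\<Sum>i=1..m. y i *\<^sub>R \<gamma> i) \<bullet> z)"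

lemma ereal_fraction_convention:
  "ereal 0 / ereal 0 = 0" "0 < c \<Longrightarrow> ereal c / ereal 0 = \<infinity>"
  "b \<noteq> 0 \<Longrightarrow> ereal a / ereal b = ereal (a / b)"
  by (simp_all add: divide_ereal_def divide_inverse flip: zero_ereal_def)

end

theory Submission
  imports Defs
begin

text \<open>The convex hull of \<open>X\<close> is already closed, and it is the projection along \<open>W\<close> of the set of
  \<open>(x, z, t, W)\<close> with \<open>(z, W) \<in> P\<close> and positive semidefinite bordered matrix \<open>[W, x; x\<^sup>T, t]\<close>
  (\<open>closure_convex_hull_X_set\<close>).  This projection is convex, it is closed since \<open>P\<close> is compact, and it
  contains \<open>X\<close>.  Conversely, if \<open>W = \<Sum>\<^sub>S \<lambda>\<^sub>S W\<^sub>S\<close>, where \<open>W\<^sub>S\<close> is the padded inverse of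
  \<open>Q\<^sub>S\<close>, then positive semidefiniteness forces \<open>x = W u\<close> for some \<open>u\<close> and \<open>t \<ge> u \<bullet> x\<close>.
  The points \<open>x\<^sub>S = W\<^sub>S u\<close> are supported in \<open>S\<close> with \<open>x\<^sub>S \<bullet> Q x\<^sub>S = u \<bullet> W\<^sub>S u\<close>, and so
  exhibit \<open>(x, z, t)\<close> as a convex combination of points of \<open>X\<close>.

  It remains to eliminate \<open>W\<close> (\<open>lifted_set_iff_ratio\<close>).  Since the inner product of two positive
  semidefinite matrices is nonnegative, an admissible \<open>W\<close> satisfies
  \<open>x \<bullet> V x \<le> t \<langle>V, W\<rangle>\<close> for every positive semidefinite \<open>V\<close>.  For
  \<open>V = \<Sum>\<^sub>i y\<^sub>i \<Gamma>\<^sub>i\<close> the right-hand side is at most \<open>t\<close> times the denominator of the ratio, by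
  \<open>weak_duality\<close>.  If no \<open>W\<close> over \<open>z\<close> is admissible, then separation yields one positive
  semidefinite \<open>V\<close> with \<open>x \<bullet> V x > t \<langle>V, W\<rangle>\<close> for all these \<open>W\<close>
  (\<open>no_psd_block_imp_separating\<close>), and \<open>strong_duality\<close> of linear programming turns the maximum of
  \<open>\<langle>V, W\<rangle>\<close> over \<open>W\<close> into multipliers \<open>y\<close> for which the ratio exceeds \<open>t\<close>.\<close>

section \<open>Linear programming duality\<close>

text \<open>Farkas' lemma: a vector \<open>b\<close> outside a finitely generated cone is strictly separated from it.
  The induction on the number of generators avoids showing that such a cone is closed.\<close>

lemma farkas:
  fixes a :: "'i \<Rightarrow> 'v::real_inner"
  assumes "finite I"
  shows "(\<exists>y. (\<forall>i\<in>I. 0 \<le> y i) \<and> (\<Sum>i\<in>I. y i *\<^sub>R a i) = b) \<or>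
         (\<exists>w. (\<forall>i\<in>I. 0 \<le> w \<bullet> a i) \<and> w \<bullet> b < 0)"
  using assms
proof (induction I arbitrary: a b rule: finite_induct)
  case empty
  show ?case
  proof (cases "b = 0")
    case False
    then have "(- b) \<bullet> b < 0" by simp
    then show ?thesis by blast
  qed simp
next
  case (insert k I)
  show ?case
  proof (cases "\<exists>y. (\<forall>i\<in>I. 0 \<le> y i) \<and> (\<Sum>i\<in>I. y i *\<^sub>R a i) = b")
    case True
    then obtain y where y: "\<forall>i\<in>I. 0 \<le> y i" "(\<Sum>i\<in>I. y i *\<^sub>R a i) = b" by blast
    have "(\<Sum>i\<in>insert k I. (y(k := 0)) i *\<^sub>R a i) = (\<Sum>i\<in>I. (y(k := 0)) i *\<^sub>R a i)"
      using insert.hyps by simp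
    also have "\<dots> = b"
      unfolding y(2)[symmetric] using insert.hyps by (intro sum.cong) auto
    finally show ?thesis using y(1) by (intro disjI1 exI[of _ "y(k := 0)"]) auto
  next
    case False
    with insert.IH[of a b] obtain w where w: "\<forall>i\<in>I. 0 \<le> w \<bullet> a i" "w \<bullet> b < 0" by blast
    show ?thesis
    proof (cases "0 \<le> w \<bullet> a k")
      case True
      with w show ?thesis by (intro disjI2 exI[of _ w]) auto
    next
      case neg: False
      \<comment> \<open>\<open>p\<close> is the projection along \<open>a k\<close> onto the hyperplane orthogonal to \<open>w\<close>; the two
        alternatives for the projected vectors lift to the two alternatives for \<open>a\<close> and \<open>b\<close>.\<close>
      define r where "r v = (w \<bullet> v) / (w \<bullet> a k)" for v
      define p where "p v = v - r v *\<^sub>R a k" for v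
      from insert.IH[of "p \<circ> a" "p b"] show ?thesis
      proof (elim disjE exE conjE)
        fix y assume y: "\<forall>i\<in>I. 0 \<le> y i" "(\<Sum>i\<in>I. y i *\<^sub>R (p \<circ> a) i) = p b"
        define c where "c = r b - (\<Sum>i\<in>I. y i * r (a i))"
        have "r b \<ge> 0" "\<forall>i\<in>I. r (a i) \<le> 0"
          using w neg by (auto simp: r_def divide_simps)
        then have "c \<ge> 0"
          using y(1) sum_nonpos[of I "\<lambda>i. y i * r (a i)"]
          by (force simp: c_def mult_nonneg_nonpos)
        have "(\<Sum>i\<in>I. y i *\<^sub>R a i) + c *\<^sub>R a k = b"
        proof -
          have "(\<Sum>i\<in>I. y i *\<^sub>R (p \<circ> a) i) = (\<Sum>i\<in>I. y i *\<^sub>R a i) - (\<Sum>i\<in>I. y i * r (a i)) *\<^sub>R a k"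
            by (simp add: p_def scaleR_diff_right sum_subtractf scaleR_sum_left)
          then have "(\<Sum>i\<in>I. y i *\<^sub>R a i) = p b + (\<Sum>i\<in>I. y i * r (a i)) *\<^sub>R a k"
            unfolding y(2) by (simp only: eq_diff_eq)
          then show ?thesis by (simp add: c_def p_def scaleR_diff_left)
        qed
        then have "(\<Sum>i\<in>insert k I. (y(k := c)) i *\<^sub>R a i) = b"
          using insert.hyps by (subst sum.insert) (auto simp: add.commute cong: if_cong intro!: sum.cong)
        then show ?thesis
          using y(1) \<open>c \<ge> 0\<close> by (intro disjI1 exI[of _ "y(k := c)"]) auto
      next
        fix w' assume w': "\<forall>i\<in>I. 0 \<le> w' \<bullet> (p \<circ> a) i" "w' \<bullet> p b < 0"
        define u where "u = w' - ((w' \<bullet> a k) / (w \<bullet> a k)) *\<^sub>R w"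
        have u: "u \<bullet> v = w' \<bullet> p v" for v
          by (simp add: u_def p_def r_def inner_diff_left inner_diff_right)
        have "p (a k) = 0" using neg by (simp add: p_def r_def)
        with w' show ?thesis
          by (intro disjI2 exI[of _ u]) (auto simp: u)
      qed
    qed
  qed
qed

text \<open>Affine Farkas lemma: an inequality valid on a nonempty polyhedron is a nonnegative
  combination of the defining inequalities, weakened on the right-hand side.\<close>

lemma lp_duality:
  fixes a :: "'i \<Rightarrow> 'v::real_inner" and b :: "'i \<Rightarrow> real"
  assumes "finite I" and feasible: "\<forall>i\<in>I. a i \<bullet> w\<^sub>0 \<le> b i"
    and bound: "\<And>w. \<forall>i\<in>I. a i \<bullet> w \<le> b i \<Longrightarrow> v \<bullet> w \<le> c"
  obtains y where "\<forall>i\<in>I. 0 \<le> y i" "(\<Sum>i\<in>I. y i *\<^sub>R a i) = v" "(\<Sum>i\<in>I. y i * b i) \<le> c"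
proof -
  \<comment> \<open>The generator \<open>(0, 1)\<close> is the slack in the last inequality of the conclusion.\<close>
  define A where "A = case_option (0::'v, 1::real) (\<lambda>i. (a i, b i))"
  define K where "K = insert None (Some ` I)"
  have "finite K" using assms(1) by (simp add: K_def)
  have sumK: "(\<Sum>k\<in>K. y k *\<^sub>R A k) = (\<Sum>i\<in>I. y (Some i) *\<^sub>R (a i, b i)) + y None *\<^sub>R (0, 1)" for y
    using assms(1) by (simp add: K_def A_def sum.reindex add.commute)
  from farkas[OF \<open>finite K\<close>, of A "(v, c)"] show thesis
  proof (elim disjE exE conjE)
    fix y assume y: "\<forall>k\<in>K. 0 \<le> y k" "(\<Sum>k\<in>K. y k *\<^sub>R A k) = (v, c)"
    have "(\<Sum>i\<in>I. y (Some i) *\<^sub>R a i) = v" "(\<Sum>i\<in>I. y (Some i) * b i) + y None = c"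
      using y(2) unfolding sumK by (simp_all add: prod_eq_iff fst_sum snd_sum)
    with y(1) show thesis by (intro that[of "y \<circ> Some"]) (auto simp: K_def)
  next
    fix ws assume "\<forall>k\<in>K. 0 \<le> ws \<bullet> A k" "ws \<bullet> (v, c) < 0"
    then obtain w s where s: "0 \<le> s" and ws: "\<forall>i\<in>I. 0 \<le> w \<bullet> a i + s * b i"
      and neg: "w \<bullet> v + s * c < 0"
      by (cases ws) (auto simp: K_def A_def inner_prod_def)
    show thesis
    proof (cases "s = 0")
      case True
      \<comment> \<open>Then \<open>- w\<close> is a direction of recession along which \<open>v\<close> is unbounded; at the
        feasible point \<open>w\<^sub>0 - r w\<close> it has the value \<open>c + 1\<close>.\<close>
      define r where "r = (c - v \<bullet> w\<^sub>0 + 1) / - (w \<bullet> v)"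
      have "v \<bullet> w\<^sub>0 \<le> c" using bound feasible by blast
      then have "r \<ge> 0" using neg True by (simp add: r_def divide_simps)
      have "a i \<bullet> (w\<^sub>0 - r *\<^sub>R w) \<le> b i" if "i \<in> I" for i
      proof -
        have "0 \<le> r * (a i \<bullet> w)"
          using ws that True \<open>r \<ge> 0\<close> by (simp add: inner_commute)
        moreover have "a i \<bullet> w\<^sub>0 \<le> b i" using feasible that by blast
        ultimately show ?thesis by (simp add: inner_diff_right)
      qed
      then have "v \<bullet> (w\<^sub>0 - r *\<^sub>R w) \<le> c" using bound by blast
      moreover have "r * (v \<bullet> w) = - (c - v \<bullet> w\<^sub>0 + 1)"
        using neg True by (simp add: r_def inner_commute)
      ultimately show ?thesis by (simp add: inner_diff_right)
    next
      case False
      then have "s > 0" using s by simp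
      have "a i \<bullet> ((- 1 / s) *\<^sub>R w) \<le> b i" if "i \<in> I" for i
        using ws that \<open>s > 0\<close> by (auto simp: field_simps inner_commute)
      then have "v \<bullet> ((- 1 / s) *\<^sub>R w) \<le> c" using bound by blast
      then show ?thesis using neg \<open>s > 0\<close> by (auto simp: field_simps inner_commute)
    qed
  qed
qed

text \<open>The same with equality constraints, whose multipliers are free in sign; \<open>J\<close> is the set of
  their indices.\<close>

lemma lp_duality_mixed:
  fixes a :: "'i \<Rightarrow> 'v::real_inner" and b :: "'i \<Rightarrow> real"
  assumes fin: "finite I" and sub: "J \<subseteq> I"
    and feasible: "\<forall>i\<in>I. if i \<in> J then a i \<bullet> w\<^sub>0 = b i else a i \<bullet> w\<^sub>0 \<le> b i"
    and bound: "\<And>w. \<forall>i\<in>I. if i \<in> J then a i \<bullet> w = b i else a i \<bullet> w \<le> b i \<Longrightarrow> v \<bullet> w \<le> c"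
  obtains y where "\<forall>i\<in>I - J. 0 \<le> y i" "(\<Sum>i\<in>I. y i *\<^sub>R a i) = v" "(\<Sum>i\<in>I. y i * b i) \<le> c"
proof -
  \<comment> \<open>Each equality becomes a pair of opposite inequalities.\<close>
  define A where "A = case_sum a (\<lambda>i. - a i)"
  define B where "B = case_sum b (\<lambda>i. - b i)"
  have eq: "(\<forall>k\<in>I <+> J. A k \<bullet> w \<le> B k) \<longleftrightarrow>
      (\<forall>i\<in>I. if i \<in> J then a i \<bullet> w = b i else a i \<bullet> w \<le> b i)" for w
  proof -
    have "(\<forall>k\<in>I <+> J. A k \<bullet> w \<le> B k) \<longleftrightarrow>
        (\<forall>i\<in>I. a i \<bullet> w \<le> b i) \<and> (\<forall>i\<in>J. b i \<le> a i \<bullet> w)"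
      by (simp add: Plus_def ball_Un A_def B_def)
    moreover have "(if i \<in> J then a i \<bullet> w = b i else a i \<bullet> w \<le> b i) \<longleftrightarrow>
        a i \<bullet> w \<le> b i \<and> (i \<in> J \<longrightarrow> b i \<le> a i \<bullet> w)" for i
      by auto
    ultimately show ?thesis using sub by blast
  qed
  have finJ: "finite J" using fin sub finite_subset by blast
  then have "finite (I <+> J)" using fin by simp
  then obtain y where y: "\<forall>k\<in>I <+> J. 0 \<le> y k" "(\<Sum>k\<in>I <+> J. y k *\<^sub>R A k) = v"
      "(\<Sum>k\<in>I <+> J. y k * B k) \<le> c"
    using lp_duality[of "I <+> J" A w\<^sub>0 B v c] feasible bound unfolding eq by blast
  define x where "x i = y (Inl i) - (if i \<in> J then y (Inr i) else 0)" for i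
  have restr: "(\<Sum>i\<in>I. if i \<in> J then f i else 0) = sum f J" for f :: "'i \<Rightarrow> 'w::comm_monoid_add"
    using fin sub by (simp add: sum.If_cases Int_absorb1)
  have xv: "x i *\<^sub>R a i = y (Inl i) *\<^sub>R a i - (if i \<in> J then y (Inr i) *\<^sub>R a i else 0)"
    and xb: "x i * b i = y (Inl i) * b i - (if i \<in> J then y (Inr i) * b i else 0)" for i
    by (simp_all add: x_def algebra_simps)
  have "(\<Sum>i\<in>I. x i *\<^sub>R a i) = v"
    using y(2) fin finJ by (simp add: xv sum_subtractf restr sum.Plus A_def sum_negf)
  moreover have "(\<Sum>i\<in>I. x i * b i) \<le> c"
    using y(3) fin finJ by (simp add: xb sum_subtractf restr sum.Plus B_def sum_negf)
  moreover have "\<forall>i\<in>I - J. 0 \<le> x i" using y(1) by (auto simp: x_def)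
  ultimately show thesis using that by blast
qed

section \<open>Positive semidefinite matrices\<close>

lemma quadratic_nonneg_imp_discriminant:
  fixes a b c :: real
  assumes "\<And>s. 0 \<le> a + 2 * s * b + s\<^sup>2 * c" "0 \<le> c"
  shows "b\<^sup>2 \<le> a * c"
proof (cases "c = 0")
  case True
  have "b = 0"
  proof (rule ccontr)
    assume "b \<noteq> 0"
    then show False using assms(1)[of "- (a + 1) / (2 * b)"] True by (simp add: field_simps)
  qed
  then show ?thesis using True by simp
next
  case False
  then have "c > 0" using assms(2) by simp
  then show ?thesis
    using assms(1)[of "- b / c"] by (simp add: field_simps power2_eq_square)
qed

text \<open>The rank-one matrix \<open>u v\<^sup>T\<close>.  Its inner product with \<open>A\<close> is the bilinear form of \<open>A\<close>
  at \<open>(u, v)\<close>, which makes the linearity and continuity in \<open>A\<close> of that form explicit.\<close>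

definition outer :: "real^'n \<Rightarrow> real^'n \<Rightarrow> real^'n^'n" where
  "outer u v = (\<chi> i j. u $ i * v $ j)"

lemma inner_outer: "A \<bullet> outer u v = u \<bullet> (A *v v)"
  by (simp add: inner_vec_def outer_def matrix_vector_mult_def sum_distrib_left mult_ac)

lemma outer_mult_vec: "outer u v *v w = (v \<bullet> w) *\<^sub>R u"
  by (simp add: vec_eq_iff outer_def matrix_vector_mult_def inner_vec_def sum_distrib_left mult_ac)

lemma transpose_outer: "transpose (outer u v) = outer v u"
  by (simp add: vec_eq_iff outer_def transpose_def mult.commute)

lemma transpose_add: "transpose (A + B) = transpose A + transpose (B :: real^'n^'n)"
  and transpose_diff: "transpose (A - B) = transpose A - transpose (B :: real^'n^'n)"
  by (simp_all add: vec_eq_iff transpose_def)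

lemma inner_transpose: "transpose A \<bullet> transpose B = A \<bullet> (B :: real^'n^'n)"
  by (simp add: inner_vec_def transpose_def) (rule sum.swap)

lemma inner_symmetric_mult:
  fixes A :: "real^'n^'n"
  assumes "transpose A = A"
  shows "u \<bullet> (A *v v) = v \<bullet> (A *v u)"
  by (metis assms dot_lmul_matrix inner_commute transpose_matrix_vector)

lemma pos_semidef_outer: "pos_semidef (outer u u)"
  by (simp add: pos_semidef_def transpose_outer outer_mult_vec inner_commute[of u])

lemma quadratic_form_add_scaleR:
  fixes A :: "real^'n^'n"
  assumes "transpose A = A"
  shows "(u + s *\<^sub>R v) \<bullet> (A *v (u + s *\<^sub>R v)) =
         u \<bullet> (A *v u) + 2 * s * (u \<bullet> (A *v v)) + s\<^sup>2 * (v \<bullet> (A *v v))"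
  using inner_symmetric_mult[OF assms, of u v]
  by (simp add: matrix_vector_right_distrib matrix_vector_mult_scaleR algebra_simps power2_eq_square)

lemma pos_semidef_cauchy_schwarz:
  assumes "pos_semidef A"
  shows "(u \<bullet> (A *v v))\<^sup>2 \<le> (u \<bullet> (A *v u)) * (v \<bullet> (A *v v))"
proof (rule quadratic_nonneg_imp_discriminant)
  have sym: "transpose A = A" using assms by (simp add: pos_semidef_def)
  show "0 \<le> u \<bullet> (A *v u) + 2 * s * (u \<bullet> (A *v v)) + s\<^sup>2 * (v \<bullet> (A *v v))" for s
    unfolding quadratic_form_add_scaleR[OF sym, symmetric]
    using assms by (simp add: pos_semidef_def)
  show "0 \<le> v \<bullet> (A *v v)" using assms by (simp add: pos_semidef_def)
qed

lemma inner_axis_mult_axis: "axis i 1 \<bullet> (A *v axis j 1) = A $ i $ j" for A :: "real^'n^'n"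
  by (simp add: inner_axis' matrix_vector_mult_basis column_def)

lemma pos_semidef_entry: "pos_semidef A \<Longrightarrow> (A $ i $ j)\<^sup>2 \<le> A $ i $ i * A $ j $ j"
  using pos_semidef_cauchy_schwarz[of A "axis i 1" "axis j 1"] by (simp add: inner_axis_mult_axis)

lemma pos_semidef_diag: "pos_semidef A \<Longrightarrow> 0 \<le> A $ i $ i"
  by (metis inner_axis_mult_axis pos_semidef_def)

text \<open>Each step of the induction splits a rank-one positive semidefinite matrix off \<open>A\<close> as in the
  Cholesky decomposition, which leaves a positive semidefinite remainder with fewer nonzero diagonal
  entries.\<close>

lemma inner_pos_semidef_nonneg:
  assumes "pos_semidef A" "pos_semidef B"
  shows "0 \<le> A \<bullet> B"
  using assms(1)
proof (induction "card {i. A $ i $ i \<noteq> 0}" arbitrary: A rule: less_induct)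
  case less
  show ?case
  proof (cases "\<exists>k. A $ k $ k \<noteq> 0")
    case False
    then have "A $ i $ j = 0" for i j
      using pos_semidef_entry[OF less.prems, of i j] by simp
    then have "A = 0" by (simp add: vec_eq_iff)
    then show ?thesis by simp
  next
    case True
    then obtain k where k: "A $ k $ k \<noteq> 0" by blast
    define c where "c = A $ k $ k"
    have "c > 0" using pos_semidef_diag[OF less.prems, of k] k by (simp add: c_def)
    define v where "v = A *v axis k 1"
    have v: "v $ i = A $ i $ k" for i by (simp add: v_def matrix_vector_mult_basis column_def)
    have c: "axis k 1 \<bullet> (A *v axis k 1) = c" by (simp add: inner_axis_mult_axis c_def)
    define A' where "A' = A - (1 / c) *\<^sub>R outer v v"
    have form: "u \<bullet> (A' *v u) = u \<bullet> (A *v u) - (u \<bullet> v)\<^sup>2 / c" for u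
      by (simp add: A'_def matrix_vector_mult_diff_rdistrib scaleR_matrix_vector_assoc[symmetric] outer_mult_vec
          inner_diff_right power2_eq_square inner_commute[of v])
    have "pos_semidef A'"
      unfolding pos_semidef_def
    proof (intro conjI allI)
      show "transpose A' = A'"
        using less.prems by (simp add: A'_def transpose_diff transpose_scalar transpose_outer pos_semidef_def)
      show "0 \<le> u \<bullet> (A' *v u)" for u
        using pos_semidef_cauchy_schwarz[OF less.prems, of u "axis k 1"] \<open>c > 0\<close>
        unfolding form c by (simp add: field_simps v_def[symmetric])
    qed
    have diag: "A' $ i $ i = A $ i $ i - (A $ i $ k)\<^sup>2 / c" for i
      by (simp add: A'_def outer_def v power2_eq_square)
    have "{i. A' $ i $ i \<noteq> 0} \<subset> {i. A $ i $ i \<noteq> 0}"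
    proof
      show "{i. A' $ i $ i \<noteq> 0} \<subseteq> {i. A $ i $ i \<noteq> 0}"
        using pos_semidef_entry[OF less.prems, of _ k] by (auto simp: diag) (metis mult_zero_left power2_less_eq_zero_iff)
      have "A' $ k $ k = 0" using \<open>c > 0\<close> by (simp add: diag c_def power2_eq_square)
      then show "{i. A' $ i $ i \<noteq> 0} \<noteq> {i. A $ i $ i \<noteq> 0}" using k by blast
    qed
    then have "card {i. A' $ i $ i \<noteq> 0} < card {i. A $ i $ i \<noteq> 0}"
      by (intro psubset_card_mono) auto
    then have "0 \<le> A' \<bullet> B" using less.hyps \<open>pos_semidef A'\<close> by blast
    moreover have "0 \<le> (1 / c) * (B \<bullet> outer v v)"
      using \<open>c > 0\<close> assms(2) by (simp add: inner_outer pos_semidef_def)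
    moreover have "A \<bullet> B = A' \<bullet> B + (1 / c) * (B \<bullet> outer v v)"
      by (simp add: A'_def inner_diff_left inner_commute[of B])
    ultimately show ?thesis by linarith
  qed
qed

lemma pos_semidef_add: "pos_semidef A \<Longrightarrow> pos_semidef B \<Longrightarrow> pos_semidef (A + B)"
  by (simp add: pos_semidef_def transpose_add matrix_vector_mult_add_rdistrib inner_add_right)

lemma pos_semidef_scaleR: "pos_semidef A \<Longrightarrow> 0 \<le> c \<Longrightarrow> pos_semidef (c *\<^sub>R A)"
  by (simp add: pos_semidef_def transpose_scalar scaleR_matrix_vector_assoc[symmetric])

lemma convex_pos_semidef: "convex {A. pos_semidef A}"
  by (auto simp: convex_def intro: pos_semidef_add pos_semidef_scaleR)

lemma closed_pos_semidef: "closed {A :: real^'n^'n. pos_semidef A}"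
proof -
  have "{A :: real^'n^'n. pos_semidef A} =
      (\<Inter>i. \<Inter>j. {A. A $ j $ i = A $ i $ j}) \<inter> (\<Inter>u. {A. 0 \<le> A \<bullet> outer u u})"
    by (auto simp: pos_semidef_def vec_eq_iff transpose_def inner_outer)
  also have "closed \<dots>"
    by (intro closed_Int closed_INT ballI closed_Collect_eq closed_Collect_le continuous_intros)
  finally show ?thesis .
qed

text \<open>The separating functional may be chosen positive semidefinite: up to sign, it is nonnegative
  on the cone of positive semidefinite matrices, in particular on the matrices \<open>u u\<^sup>T\<close>.\<close>

lemma pos_semidef_separation:
  fixes T :: "(real^'n^'n) set"
  assumes "convex T" "compact T" "T \<noteq> {}" and sym: "\<And>M. M \<in> T \<Longrightarrow> transpose M = M"
    and disj: "\<And>M. M \<in> T \<Longrightarrow> \<not> pos_semidef M"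
  obtains V where "pos_semidef V" "\<And>M. M \<in> T \<Longrightarrow> V \<bullet> M < 0"
proof -
  obtain G b where GP: "\<And>M. pos_semidef M \<Longrightarrow> G \<bullet> M < b" and GT: "\<And>M. M \<in> T \<Longrightarrow> b < G \<bullet> M"
  proof -
    have "{A. pos_semidef A} \<inter> T = {}" using disj by blast
    from separating_hyperplane_closed_compact[OF convex_pos_semidef closed_pos_semidef assms(1-3) this]
    show ?thesis using that by blast
  qed
  have "pos_semidef (0 :: real^'n^'n)"
    by (simp add: pos_semidef_def transpose_def vec_eq_iff)
  then have "0 < b" using GP[of 0] by simp
  have cone: "G \<bullet> M \<le> 0" if "pos_semidef M" for M
  proof (rule ccontr)
    assume "\<not> ?thesis"
    then have "G \<bullet> ((b / (G \<bullet> M)) *\<^sub>R M) = b" "b / (G \<bullet> M) \<ge> 0" using \<open>0 < b\<close> by simp_all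
    then show False using GP[OF pos_semidef_scaleR[OF that]] by fastforce
  qed
  \<comment> \<open>As a functional on symmetric matrices, \<open>- G\<close> agrees with its symmetric part.\<close>
  define V where "V = (- 1 / 2) *\<^sub>R (G + transpose G)"
  have V: "V \<bullet> M = - (G \<bullet> M)" if "transpose M = M" for M
    using inner_transpose[of G M] that by (simp add: V_def inner_add_left)
  show thesis
  proof
    show "pos_semidef V"
      unfolding pos_semidef_def
    proof (intro conjI allI)
      show "transpose V = V" unfolding V_def transpose_scalar transpose_add transpose_transpose by (simp add: add.commute)
      show "0 \<le> u \<bullet> (V *v u)" for u
        using cone[OF pos_semidef_outer[of u]] V[of "outer u u"]
        by (simp add: inner_outer transpose_outer)
    qed
    show "V \<bullet> M < 0" if "M \<in> T" for M
      using GT[OF that] V[OF sym[OF that]] \<open>0 < b\<close> by simp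
  qed
qed

section \<open>The convex hull as a projection\<close>

text \<open>The bordered matrix with blocks \<open>W\<close>, \<open>x\<close>, \<open>x\<^sup>T\<close>, \<open>t\<close> has a nonnegative quadratic form; the
  vector it is applied to is \<open>(u, s)\<close>.  Symmetry of \<open>W\<close> is not part of the notion.\<close>

definition psd_block :: "real^'n^'n \<Rightarrow> real^'n \<Rightarrow> real \<Rightarrow> bool" where
  "psd_block W x t \<longleftrightarrow> (\<forall>u s. 0 \<le> u \<bullet> (W *v u) + 2 * s * (u \<bullet> x) + s\<^sup>2 * t)"

text \<open>The projection of \<open>{(x, z, t, W). (z, W) \<in> P, psd_block W x t}\<close> along \<open>W\<close>.\<close>

definition lifted_set :: "real^'n^'n \<Rightarrow> (real^'n) set \<Rightarrow> ((real^'n) \<times> (real^'n) \<times> real) set" where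
  "lifted_set Q Z = {(x, z, t). \<exists>W. (z, W) \<in> P_polytope Q Z \<and> psd_block W x t}"

lemma psd_block_nonneg: "psd_block W x t \<Longrightarrow> 0 \<le> t"
  unfolding psd_block_def by (elim allE[of _ 0] allE[of _ 1]) simp

lemma psd_block_discriminant:
  assumes "psd_block W x t"
  shows "(u \<bullet> x)\<^sup>2 \<le> t * (u \<bullet> (W *v u))"
proof -
  have "0 \<le> u \<bullet> (W *v u) + 2 * s * (u \<bullet> x) + s\<^sup>2 * t" for s
    using assms by (simp add: psd_block_def)
  from quadratic_nonneg_imp_discriminant[OF this psd_block_nonneg[OF assms]]
  show ?thesis by (simp only: mult.commute)
qed

lemma psd_block_combination:
  assumes "psd_block W x t" "psd_block W' x' t'" "0 \<le> a" "0 \<le> b"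
  shows "psd_block (a *\<^sub>R W + b *\<^sub>R W') (a *\<^sub>R x + b *\<^sub>R x') (a * t + b * t')"
  unfolding psd_block_def
proof (intro allI)
  fix u s
  have "0 \<le> a * (u \<bullet> (W *v u) + 2 * s * (u \<bullet> x) + s\<^sup>2 * t) +
            b * (u \<bullet> (W' *v u) + 2 * s * (u \<bullet> x') + s\<^sup>2 * t')"
    using assms by (simp add: psd_block_def)
  then show "0 \<le> u \<bullet> ((a *\<^sub>R W + b *\<^sub>R W') *v u) + 2 * s * (u \<bullet> (a *\<^sub>R x + b *\<^sub>R x')) + s\<^sup>2 * (a * t + b * t')"
    by (simp add: matrix_vector_mult_add_rdistrib scaleR_matrix_vector_assoc[symmetric] inner_add_right algebra_simps)
qed

text \<open>By the discriminant bound, \<open>x\<close> is orthogonal to the kernel of \<open>W\<close>, which is the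
  orthogonal complement of the range of a symmetric \<open>W\<close>.\<close>

lemma psd_block_imp_range:
  assumes "psd_block W x t" "transpose W = W"
  obtains u where "W *v u = x"
proof -
  have sub: "subspace (range ((*v) W))"
    by (intro linear_subspace_image matrix_vector_mul_linear subspace_UNIV)
  obtain y w where yw: "y \<in> range ((*v) W)" "\<And>v. v \<in> range ((*v) W) \<Longrightarrow> orthogonal w v" "x = y + w"
    using orthogonal_subspace_decomp_exists[of "range ((*v) W)" x] span_eq_iff[THEN iffD2, OF sub] by metis
  have "(W *v w) \<bullet> (W *v w) = w \<bullet> (W *v (W *v w))"
    using inner_symmetric_mult[OF assms(2)] by simp
  also have "\<dots> = 0" using yw(2) by (simp add: orthogonal_def)
  finally have "W *v w = 0" by simp
  then have "w \<bullet> x = 0" using psd_block_discriminant[OF assms(1), of w] by simp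
  moreover have "w \<bullet> y = 0" using yw(1,2) by (simp add: orthogonal_def)
  ultimately have "w = 0" using yw(3) by (simp add: inner_add_right)
  then show thesis using yw that by auto
qed

lemma ind_vec_vertex:
  assumes "Z \<subseteq> {z. \<forall>i. z $ i \<in> {0, 1}}" "z \<in> Z"
  shows "z = ind_vec {i. z $ i = 1}"
proof -
  have "z $ i = 0 \<or> z $ i = 1" for i using assms by blast
  then show ?thesis by (auto simp: vec_eq_iff ind_vec_def)
qed

lemma support_iff_complementarity: "x * (1 - ind_vec S) = 0 \<longleftrightarrow> (\<forall>i. i \<notin> S \<longrightarrow> x $ i = 0)"
  by (auto simp: vec_eq_iff ind_vec_def)

lemma padded_inverse_support:
  assumes "pos_def Q" "i \<notin> S"
  shows "(padded_inverse Q S *v u) $ i = 0"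
  using padded_inverse(2)[OF assms(1)] assms(2) by (simp add: matrix_vector_mult_def)

lemma padded_inverse_left_inverse:
  assumes Q: "pos_def Q" and x: "\<forall>i. i \<notin> S \<longrightarrow> x $ i = 0"
  shows "padded_inverse Q S *v (Q *v x) = x"
proof -
  let ?W = "padded_inverse Q S"
  note zero = padded_inverse(2)[OF Q, of _ S]
  have "(?W *v (Q *v x)) $ i = x $ i" if "i \<in> S" for i
  proof -
    have "(?W *v (Q *v x)) $ i = (\<Sum>k\<in>S. ?W $ i $ k * (\<Sum>j\<in>S. Q $ k $ j * x $ j))"
      unfolding matrix_vector_mult_def vec_lambda_beta
      using zero x by (intro sum.mono_neutral_cong_right arg_cong2[where f="(*)"]) auto
    also have "\<dots> = (\<Sum>j\<in>S. (\<Sum>k\<in>S. ?W $ i $ k * Q $ k $ j) * x $ j)"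
      unfolding sum_distrib_left sum_distrib_right by (subst sum.swap) (simp add: mult.assoc)
    also have "\<dots> = (\<Sum>j\<in>S. (if i = j then 1 else 0) * x $ j)"
      using padded_inverse(1)[OF Q, of S] that by (intro sum.cong) (auto simp: inverse_on_def)
    also have "\<dots> = x $ i"
      using that by (simp add: if_distrib[of "\<lambda>a. a * _"] cong: if_cong)
    finally show ?thesis .
  qed
  moreover have "(?W *v (Q *v x)) $ i = x $ i" if "i \<notin> S" for i
    using x that by (simp add: padded_inverse_support[OF Q])
  ultimately show ?thesis unfolding vec_eq_iff by blast
qed

lemma transpose_padded_inverse:
  fixes Q :: "real^'n^'n"
  assumes Q: "pos_def Q"
  shows "transpose (padded_inverse Q S) = padded_inverse Q S"
proof -
  let ?W = "padded_inverse Q S"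
  have Qsym: "Q $ i $ j = Q $ j $ i" for i j
  proof -
    have "transpose Q $ j $ i = Q $ j $ i" using Q by (simp add: pos_def_def)
    then show ?thesis by (simp add: transpose_def)
  qed
  have "inverse_on S Q (transpose ?W)"
    unfolding inverse_on_def
  proof (intro ballI conjI)
    fix i j assume "i \<in> S" "j \<in> S"
    then have WQ: "(\<Sum>k\<in>S. ?W $ j $ k * Q $ k $ i) = (if i = j then 1 else 0)"
      and QW: "(\<Sum>k\<in>S. Q $ j $ k * ?W $ k $ i) = (if i = j then 1 else 0)"
      using padded_inverse(1)[OF Q, of S] by (simp_all add: inverse_on_def eq_commute[of j i])
    have "(\<Sum>k\<in>S. Q $ i $ k * transpose ?W $ k $ j) = (\<Sum>k\<in>S. ?W $ j $ k * Q $ k $ i)"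
      unfolding transpose_def vec_lambda_beta by (intro sum.cong refl) (subst Qsym, rule mult.commute)
    then show "(\<Sum>k\<in>S. Q $ i $ k * transpose ?W $ k $ j) = (if i = j then 1 else 0)"
      by (simp only: WQ)
    have "(\<Sum>k\<in>S. transpose ?W $ i $ k * Q $ k $ j) = (\<Sum>k\<in>S. Q $ j $ k * ?W $ k $ i)"
      unfolding transpose_def vec_lambda_beta by (intro sum.cong refl) (subst Qsym, rule mult.commute)
    then show "(\<Sum>k\<in>S. transpose ?W $ i $ k * Q $ k $ j) = (if i = j then 1 else 0)"
      by (simp only: QW)
  qed
  then have "transpose ?W $ i $ j = ?W $ i $ j" if "i \<in> S" "j \<in> S" for i j
    using inverse_on_unique padded_inverse(1)[OF Q] that by blast
  moreover have "transpose ?W $ i $ j = ?W $ i $ j" if "i \<notin> S \<or> j \<notin> S" for i j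
    using padded_inverse(2)[OF Q] that by (auto simp: transpose_def)
  ultimately show ?thesis unfolding vec_eq_iff by blast
qed

text \<open>With \<open>W = padded_inverse Q S\<close> this is \<open>W Q W = W\<close>, read as an identity of quadratic forms.\<close>

lemma padded_inverse_form:
  assumes Q: "pos_def Q"
  shows "(padded_inverse Q S *v u) \<bullet> (Q *v (padded_inverse Q S *v u)) = u \<bullet> (padded_inverse Q S *v u)"
proof -
  let ?W = "padded_inverse Q S"
  have "(?W *v u) \<bullet> (Q *v (?W *v u)) = u \<bullet> (?W *v (Q *v (?W *v u)))"
    using inner_symmetric_mult[OF transpose_padded_inverse[OF Q, of S], of "Q *v (?W *v u)" u]
    by (simp add: inner_commute)
  then show ?thesis
    using padded_inverse_left_inverse[OF Q] padded_inverse_support[OF Q] by simp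
qed

lemma pos_def_imp_pos_semidef: "pos_def Q \<Longrightarrow> pos_semidef Q"
  unfolding pos_def_def pos_semidef_def
proof (elim conjE, intro conjI allI)
  fix x assume pos: "\<forall>x. x \<noteq> 0 \<longrightarrow> 0 < x \<bullet> (Q *v x)"
  show "0 \<le> x \<bullet> (Q *v x)"
    using pos by (cases "x = 0") (auto intro: less_imp_le)
qed

lemma pos_semidef_padded_inverse:
  assumes "pos_def Q"
  shows "pos_semidef (padded_inverse Q S)"
  unfolding pos_semidef_def padded_inverse_form[OF assms, symmetric]
  using transpose_padded_inverse[OF assms] pos_def_imp_pos_semidef[OF assms]
  by (auto simp only: pos_semidef_def)

lemma P_polytope_pos_semidef:
  assumes "pos_def Q" "(z, W) \<in> P_polytope Q Z"
  shows "pos_semidef W"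
proof -
  have "P_polytope Q Z \<subseteq> UNIV \<times> {W. pos_semidef W}"
    unfolding P_polytope_def
    by (intro hull_minimal convex_Times convex_UNIV convex_pos_semidef)
      (auto simp: pos_semidef_padded_inverse[OF assms(1)])
  then show ?thesis using assms(2) by blast
qed

lemma compact_P_polytope: "compact (P_polytope Q Z)"
  unfolding P_polytope_def by (intro finite_imp_compact_convex_hull) simp

lemma fst_P_polytope:
  assumes "Z \<subseteq> {z. \<forall>i. z $ i \<in> {0, 1}}"
  shows "fst ` P_polytope Q Z = convex hull Z"
proof -
  have "fst ` {(ind_vec S, padded_inverse Q S) | S. ind_vec S \<in> Z} = Z"
    using ind_vec_vertex[OF assms] by (force simp: image_iff)
  then show ?thesis unfolding P_polytope_def by (simp add: convex_hull_linear_image linear_fst)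
qed

text \<open>For a point of \<open>X\<close> with support in \<open>S\<close> and \<open>W = padded_inverse Q S\<close>, completing the square
  bounds the bordered quadratic form below by that of \<open>Q\<close> at \<open>W u + s x\<close>.\<close>

lemma X_set_subset_lifted_set:
  assumes Q: "pos_def Q" and Z: "Z \<subseteq> {z. \<forall>i. z $ i \<in> {0, 1}}"
  shows "X_set Q Z \<subseteq> lifted_set Q Z"
proof (rule subsetI)
  fix p assume "p \<in> X_set Q Z"
  then obtain x z t where p: "p = (x, z, t)" and z: "z \<in> Z" and t: "x \<bullet> (Q *v x) \<le> t"
    and xz: "x * (1 - z) = 0" by (auto simp: X_set_def)
  obtain S where S: "z = ind_vec S" using ind_vec_vertex[OF Z z] by blast
  let ?W = "padded_inverse Q S"
  have WQx: "?W *v (Q *v x) = x"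
    using padded_inverse_left_inverse[OF Q] xz unfolding S support_iff_complementarity by blast
  have Qsym: "transpose Q = Q" using Q by (simp add: pos_def_def)
  have "0 \<le> u \<bullet> (?W *v u) + 2 * s * (u \<bullet> x) + s\<^sup>2 * t" for u s
  proof -
    have "0 \<le> (?W *v u + s *\<^sub>R x) \<bullet> (Q *v (?W *v u + s *\<^sub>R x))"
      using pos_def_imp_pos_semidef[OF Q] by (simp add: pos_semidef_def)
    also have "\<dots> = u \<bullet> (?W *v u) + 2 * s * ((?W *v u) \<bullet> (Q *v x)) + s\<^sup>2 * (x \<bullet> (Q *v x))"
      unfolding quadratic_form_add_scaleR[OF Qsym] padded_inverse_form[OF Q] ..
    also have "(?W *v u) \<bullet> (Q *v x) = u \<bullet> x"
      using inner_symmetric_mult[OF transpose_padded_inverse[OF Q, of S], of u "Q *v x"] WQx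
      by (simp add: inner_commute)
    also have "u \<bullet> (?W *v u) + 2 * s * (u \<bullet> x) + s\<^sup>2 * (x \<bullet> (Q *v x)) \<le> u \<bullet> (?W *v u) + 2 * s * (u \<bullet> x) + s\<^sup>2 * t"
      using t by (simp add: mult_left_mono)
    finally show ?thesis .
  qed
  then have "psd_block ?W x t" by (simp add: psd_block_def)
  moreover have "(z, ?W) \<in> P_polytope Q Z"
    unfolding P_polytope_def using z S by (intro hull_inc) blast
  ultimately show "p \<in> lifted_set Q Z" unfolding p lifted_set_def by blast
qed

lemma convex_lifted_set: "convex (lifted_set Q Z)"
proof (rule convexI)
  fix p p' and a b :: real
  assume ab: "0 \<le> a" "0 \<le> b" "a + b = 1" and "p \<in> lifted_set Q Z" "p' \<in> lifted_set Q Z"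
  then obtain x z t W x' z' t' W' where
    p: "p = (x, z, t)" "(z, W) \<in> P_polytope Q Z" "psd_block W x t" and
    p': "p' = (x', z', t')" "(z', W') \<in> P_polytope Q Z" "psd_block W' x' t'"
    by (auto simp: lifted_set_def)
  have "convex (P_polytope Q Z)" by (simp add: P_polytope_def)
  from convexD[OF this p(2) p'(2) ab]
  have "(a *\<^sub>R z + b *\<^sub>R z', a *\<^sub>R W + b *\<^sub>R W') \<in> P_polytope Q Z" by simp
  with psd_block_combination[OF p(3) p'(3) ab(1,2)]
  show "a *\<^sub>R p + b *\<^sub>R p' \<in> lifted_set Q Z"
    unfolding p(1) p'(1) lifted_set_def by auto
qed

text \<open>Closedness is preserved by the projection because the polytope is compact.\<close>

lemma closed_lifted_set: "closed (lifted_set Q Z)"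
proof -
  define T where "T = {q :: (real^'a^'a) \<times> (real^'a) \<times> (real^'a) \<times> real.
      (fst (snd (snd q)), fst q) \<in> P_polytope Q Z} \<inter>
    (\<Inter>u. \<Inter>s. {q. 0 \<le> fst q \<bullet> outer u u + 2 * s * (u \<bullet> fst (snd q)) + s\<^sup>2 * snd (snd (snd q))})"
  have "closed {q :: (real^'a^'a) \<times> (real^'a) \<times> (real^'a) \<times> real.
      (fst (snd (snd q)), fst q) \<in> P_polytope Q Z}"
    using closed_vimage[OF compact_imp_closed[OF compact_P_polytope[of Q Z]],
        of "\<lambda>q :: (real^'a^'a) \<times> (real^'a) \<times> (real^'a) \<times> real. (fst (snd (snd q)), fst q)"]
    by (simp add: vimage_def continuous_intros)
  then have "closed T"
    unfolding T_def by (intro closed_Int closed_INT ballI closed_Collect_le continuous_intros)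
  moreover have "compact (snd ` P_polytope Q Z)"
    by (intro compact_continuous_image compact_P_polytope continuous_intros)
  ultimately have "closed {y. \<exists>W. W \<in> snd ` P_polytope Q Z \<and> (W, y) \<in> T}"
    by (rule closed_compact_projection[rotated])
  also have "{y. \<exists>W. W \<in> snd ` P_polytope Q Z \<and> (W, y) \<in> T} = lifted_set Q Z"
  proof -
    have "(W, x, z, t) \<in> T \<longleftrightarrow> (z, W) \<in> P_polytope Q Z \<and> psd_block W x t" for W x z t
      by (simp add: T_def psd_block_def inner_outer)
    then show ?thesis unfolding lifted_set_def by (auto intro: rev_bexI)
  qed
  finally show ?thesis .
qed

text \<open>Write \<open>x = W u\<close>.  For this fixed \<open>u\<close>, the point \<open>(W u, z, u \<bullet> W u)\<close> depends linearly on
  \<open>(z, W)\<close> and lies in \<open>X\<close> at the vertices of the polytope, hence in the convex hull of \<open>X\<close> for all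
  \<open>(z, W)\<close> in it; moreover \<open>u \<bullet> W u \<le> t\<close>.\<close>

lemma lifted_set_subset_convex_hull:
  assumes Q: "pos_def Q"
  shows "lifted_set Q Z \<subseteq> convex hull (X_set Q Z)"
proof (rule subsetI)
  fix p assume "p \<in> lifted_set Q Z"
  then obtain x z t W where p: "p = (x, z, t)" and zW: "(z, W) \<in> P_polytope Q Z"
    and block: "psd_block W x t"
    by (auto simp: lifted_set_def)
  have "transpose W = W" using P_polytope_pos_semidef[OF Q zW] by (simp add: pos_semidef_def)
  then obtain u where u: "W *v u = x" using psd_block_imp_range[OF block] by blast
  \<comment> \<open>The bordered form at \<open>(- u, 1)\<close> is \<open>t - u \<bullet> x\<close>.\<close>
  have "0 \<le> (-u) \<bullet> (W *v (-u)) + 2 * 1 * ((-u) \<bullet> x) + 1\<^sup>2 * t"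
    using block unfolding psd_block_def by blast
  then have t: "u \<bullet> x \<le> t" using u matrix_vector_mult_scaleR[of W "-1" u] by simp
  define L where "L = (\<lambda>(z :: real^'a, W). (W *v u, z, u \<bullet> (W *v u)))"
  have "linear L"
    by (intro linearI)
      (auto simp: L_def matrix_vector_mult_add_rdistrib inner_add_right scaleR_matrix_vector_assoc[symmetric])
  have gen: "L ` {(ind_vec S, padded_inverse Q S) | S. ind_vec S \<in> Z} \<subseteq> X_set Q Z"
    using padded_inverse_support[OF Q]
    by (auto simp: L_def X_set_def support_iff_complementarity padded_inverse_form[OF Q])
  \<comment> \<open>\<open>X\<close> is closed under increasing \<open>t\<close>.\<close>
  define shift where "shift = (\<lambda>q. (0 :: real^'a, 0 :: real^'a, t - u \<bullet> x) + q)"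
  have "(x, z, u \<bullet> x) \<in> L ` P_polytope Q Z"
    using zW u by (force simp: L_def)
  also have "\<dots> = convex hull (L ` {(ind_vec S, padded_inverse Q S) | S. ind_vec S \<in> Z})"
    unfolding P_polytope_def by (rule convex_hull_linear_image[OF \<open>linear L\<close>])
  also have "\<dots> \<subseteq> convex hull (X_set Q Z)" by (rule hull_mono[OF gen])
  finally have "shift (x, z, u \<bullet> x) \<in> shift ` (convex hull (X_set Q Z))" by blast
  also have "\<dots> = convex hull (shift ` X_set Q Z)"
    unfolding shift_def by (rule convex_hull_translation[symmetric])
  also have "\<dots> \<subseteq> convex hull (X_set Q Z)"
    by (rule hull_mono) (use t in \<open>auto simp: shift_def X_set_def\<close>)
  finally show "p \<in> convex hull (X_set Q Z)" by (simp add: shift_def p)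
qed

proposition closure_convex_hull_X_set:
  assumes "pos_def Q" "Z \<subseteq> {z. \<forall>i. z $ i \<in> {0, 1}}"
  shows "closure (convex hull (X_set Q Z)) = lifted_set Q Z"
proof
  show "closure (convex hull (X_set Q Z)) \<subseteq> lifted_set Q Z"
    by (intro closure_minimal hull_minimal X_set_subset_lifted_set convex_lifted_set closed_lifted_set assms)
  show "lifted_set Q Z \<subseteq> closure (convex hull (X_set Q Z))"
    using lifted_set_subset_convex_hull[OF assms(1)] closure_subset by blast
qed

section \<open>Dual description of the lifted set\<close>

lemma ereal_divide_le_iff:
  assumes "0 \<le> a" "0 \<le> b" "0 \<le> t"
  shows "ereal a / ereal b \<le> ereal t \<longleftrightarrow> a \<le> t * b"
proof (cases "b = 0")
  case True
  show ?thesis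
  proof (cases "a = 0")
    case True
    then have "ereal a / ereal b = 0" using \<open>b = 0\<close> ereal_fraction_convention(1) by (simp only:)
    then show ?thesis using assms True \<open>b = 0\<close> by simp
  next
    case False
    then have "ereal a / ereal b = \<infinity>"
      using assms \<open>b = 0\<close> ereal_fraction_convention(2)[of a] by (simp only:)
    then show ?thesis using assms False \<open>b = 0\<close> by simp
  qed
next
  case False
  then show ?thesis using assms by (simp add: ereal_fraction_convention(3) divide_le_eq)
qed

text \<open>For \<open>(z, W)\<close> satisfying the constraints, the denominator of the ratio bounds \<open>\<langle>\<Sum>\<^sub>i y\<^sub>i \<Gamma>\<^sub>i, W\<rangle>\<close>
  from above.\<close>

lemma weak_duality:
  assumes "(z, W) \<in> solution_set m1 {1..m} \<Gamma> \<gamma> \<beta>" and "\<forall>i\<in>{1..m1}. 0 \<le> y i"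
  shows "(\<Sum>i=1..m. y i *\<^sub>R \<Gamma> i) \<bullet> W \<le> (\<Sum>i=1..m. y i * \<beta> i) + (\<Sum>i=1..m. y i *\<^sub>R \<gamma> i) \<bullet> z"
proof -
  have "y i * (\<Gamma> i \<bullet> W) \<le> y i * (\<beta> i + \<gamma> i \<bullet> z)" if i: "i \<in> {1..m}" for i
  proof (cases "i \<le> m1")
    case True
    then have "\<Gamma> i \<bullet> W - \<gamma> i \<bullet> z \<le> \<beta> i" "0 \<le> y i"
      using assms i by (auto simp: solution_set_def)
    then show ?thesis by (intro mult_left_mono) auto
  next
    case False
    then have "\<Gamma> i \<bullet> W - \<gamma> i \<bullet> z = \<beta> i" using assms i by (auto simp: solution_set_def)
    then have "\<Gamma> i \<bullet> W = \<beta> i + \<gamma> i \<bullet> z" by simp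
    then show ?thesis by simp
  qed
  then have "(\<Sum>i=1..m. y i * (\<Gamma> i \<bullet> W)) \<le> (\<Sum>i=1..m. y i * (\<beta> i + \<gamma> i \<bullet> z))"
    by (intro sum_mono)
  then show ?thesis by (simp add: inner_sum_left algebra_simps sum.distrib)
qed

text \<open>Conversely, a bound \<open>c\<close> on \<open>\<langle>V, W\<rangle>\<close> over the nonempty fibre of the solution set above \<open>z\<close> is certified by
  multipliers \<open>y\<close> that represent \<open>V\<close> exactly.\<close>

lemma strong_duality:
  assumes "m1 \<le> m" "(z, W\<^sub>0) \<in> solution_set m1 {1..m} \<Gamma> \<gamma> \<beta>"
    and bound: "\<And>W. (z, W) \<in> solution_set m1 {1..m} \<Gamma> \<gamma> \<beta> \<Longrightarrow> V \<bullet> W \<le> c"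
  obtains y where "y \<in> extensional {1..m}" "\<forall>i\<in>{1..m1}. 0 \<le> y i" "(\<Sum>i=1..m. y i *\<^sub>R \<Gamma> i) = V"
    "(\<Sum>i=1..m. y i * \<beta> i) + (\<Sum>i=1..m. y i *\<^sub>R \<gamma> i) \<bullet> z \<le> c"
proof -
  have mem: "(z, W) \<in> solution_set m1 {1..m} \<Gamma> \<gamma> \<beta> \<longleftrightarrow>
      (\<forall>i\<in>{1..m}. if i \<in> {m1<..m} then \<Gamma> i \<bullet> W = \<beta> i + \<gamma> i \<bullet> z else \<Gamma> i \<bullet> W \<le> \<beta> i + \<gamma> i \<bullet> z)" for W
    unfolding solution_set_def mem_Collect_eq case_prod_conv by (intro ball_cong) auto
  obtain y where y: "\<forall>i\<in>{1..m} - {m1<..m}. 0 \<le> y i" "(\<Sum>i=1..m. y i *\<^sub>R \<Gamma> i) = V"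
      "(\<Sum>i=1..m. y i * (\<beta> i + \<gamma> i \<bullet> z)) \<le> c"
  proof (rule lp_duality_mixed[of "{1..m}" "{m1<..m}" \<Gamma> W\<^sub>0 "\<lambda>i. \<beta> i + \<gamma> i \<bullet> z" V c])
    show "{m1<..m} \<subseteq> {1..m}" by auto
  qed (use assms in \<open>auto simp only: mem\<close>)
  define y' where "y' = restrict y {1..m}"
  show thesis
  proof
    show "y' \<in> extensional {1..m}" by (simp add: y'_def)
    show "\<forall>i\<in>{1..m1}. 0 \<le> y' i" using y(1) \<open>m1 \<le> m\<close> by (auto simp: y'_def)
    show "(\<Sum>i=1..m. y' i *\<^sub>R \<Gamma> i) = V" using y(2) by (simp add: y'_def)
    show "(\<Sum>i=1..m. y' i * \<beta> i) + (\<Sum>i=1..m. y' i *\<^sub>R \<gamma> i) \<bullet> z \<le> c"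
      using y(3) by (simp add: y'_def inner_sum_left algebra_simps sum.distrib)
  qed
qed

lemma trace_sum_scaleR: "trace (\<Sum>i\<in>I. y i *\<^sub>R A i) = (\<Sum>i\<in>I. trace (A i) * y i)" for A :: "'i \<Rightarrow> real^'n^'n"
proof -
  have "trace (\<Sum>i\<in>I. y i *\<^sub>R A i) = (\<Sum>j\<in>UNIV. \<Sum>i\<in>I. A i $ j $ j * y i)"
    by (simp add: trace_def mult.commute)
  also have "\<dots> = (\<Sum>i\<in>I. trace (A i) * y i)"
    unfolding trace_def sum_distrib_right by (rule sum.swap)
  finally show ?thesis .
qed

text \<open>When \<open>(z, W)\<close> satisfies the constraints for some positive semidefinite \<open>W\<close>, numerator and
  denominator are nonnegative and the fraction can be cleared; \<open>0/0 = 0\<close> and \<open>c/0 = \<infinity>\<close> make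
  this correct for a vanishing denominator too.\<close>

lemma ratio_le_iff:
  assumes "(z, W) \<in> solution_set m1 {1..m} \<Gamma> \<gamma> \<beta>" "pos_semidef W" "y \<in> Y_set m1 m \<Gamma>" "0 \<le> t"
  shows "ratio m \<Gamma> \<gamma> \<beta> x z y \<le> ereal t \<longleftrightarrow>
    x \<bullet> ((\<Sum>i=1..m. y i *\<^sub>R \<Gamma> i) *v x) \<le>
      t * ((\<Sum>i=1..m. y i * \<beta> i) + (\<Sum>i=1..m. y i *\<^sub>R \<gamma> i) \<bullet> z)"
  unfolding ratio_def
proof (rule ereal_divide_le_iff)
  have V: "pos_semidef (\<Sum>i=1..m. y i *\<^sub>R \<Gamma> i)" and y: "\<forall>i\<in>{1..m1}. 0 \<le> y i"
    using assms(3) by (auto simp: Y_set_def)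
  show "0 \<le> x \<bullet> ((\<Sum>i=1..m. y i *\<^sub>R \<Gamma> i) *v x)"
    using V by (simp add: pos_semidef_def)
  show "0 \<le> (\<Sum>i=1..m. y i * \<beta> i) + (\<Sum>i=1..m. y i *\<^sub>R \<gamma> i) \<bullet> z"
    using inner_pos_semidef_nonneg[OF V assms(2)] weak_duality[OF assms(1) y] by linarith
qed (rule assms)

text \<open>The matrix \<open>t W - x x\<^sup>T\<close> is positive semidefinite, hence has nonnegative inner product
  with \<open>V\<close>.\<close>

lemma psd_block_imp_bound:
  assumes "psd_block W x t" "pos_semidef W" "pos_semidef V"
  shows "x \<bullet> (V *v x) \<le> t * (V \<bullet> W)"
proof -
  have "pos_semidef (t *\<^sub>R W - outer x x)"
    unfolding pos_semidef_def
  proof (intro conjI allI)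
    show "transpose (t *\<^sub>R W - outer x x) = t *\<^sub>R W - outer x x"
      using assms(2) by (simp add: transpose_diff transpose_scalar transpose_outer pos_semidef_def)
    show "0 \<le> u \<bullet> ((t *\<^sub>R W - outer x x) *v u)" for u
      using psd_block_discriminant[OF assms(1), of u]
      by (simp add: matrix_vector_mult_diff_rdistrib scaleR_matrix_vector_assoc[symmetric] outer_mult_vec
          inner_diff_right power2_eq_square inner_commute[of x])
  qed
  then have "0 \<le> V \<bullet> (t *\<^sub>R W - outer x x)" by (rule inner_pos_semidef_nonneg[OF assms(3)])
  then show ?thesis by (simp add: inner_diff_right inner_outer)
qed

lemma psd_block_schur:
  assumes "pos_semidef (t *\<^sub>R W - outer x x)" "0 < t"
  shows "psd_block W x t"
  unfolding psd_block_def
proof (intro allI)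
  fix u s
  have "0 \<le> u \<bullet> ((t *\<^sub>R W - outer x x) *v u)" using assms(1) by (simp add: pos_semidef_def)
  then have "(u \<bullet> x)\<^sup>2 \<le> t * (u \<bullet> (W *v u))"
    by (simp add: matrix_vector_mult_diff_rdistrib scaleR_matrix_vector_assoc[symmetric] outer_mult_vec
        inner_diff_right power2_eq_square inner_commute[of x])
  moreover have "0 \<le> (u \<bullet> x + s * t)\<^sup>2" by simp
  ultimately have "0 \<le> t * (u \<bullet> (W *v u) + 2 * s * (u \<bullet> x) + s\<^sup>2 * t)"
    by (simp add: algebra_simps power2_eq_square)
  then show "0 \<le> u \<bullet> (W *v u) + 2 * s * (u \<bullet> x) + s\<^sup>2 * t"
    using \<open>0 < t\<close> by (simp add: zero_le_mult_iff)
qed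

text \<open>If no member of \<open>K\<close> fits into a positive semidefinite bordered matrix with \<open>x\<close> and \<open>t\<close>, one
  matrix \<open>V\<close> witnesses this for all of \<open>K\<close>.  For \<open>t > 0\<close> it separates \<open>t K - x x\<^sup>T\<close> from the
  positive semidefinite cone; for \<open>t = 0\<close> necessarily \<open>x \<noteq> 0\<close> and the identity matrix will do.\<close>

lemma no_psd_block_imp_separating:
  fixes K :: "(real^'n^'n) set"
  assumes "compact K" "convex K" "K \<noteq> {}" and psd: "\<And>W. W \<in> K \<Longrightarrow> pos_semidef W"
    and "0 \<le> t" and no: "\<And>W. W \<in> K \<Longrightarrow> \<not> psd_block W x t"
  obtains V where "pos_semidef V" "\<And>W. W \<in> K \<Longrightarrow> t * (V \<bullet> W) < x \<bullet> (V *v x)"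
proof (cases "t = 0")
  case True
  obtain W where W: "W \<in> K" using \<open>K \<noteq> {}\<close> by blast
  have "x \<noteq> 0"
  proof
    assume "x = 0"
    then have "psd_block W x t" using psd[OF W] True by (simp add: psd_block_def pos_semidef_def)
    then show False using no[OF W] by blast
  qed
  show thesis
  proof
    show "pos_semidef (mat 1 :: real^'n^'n)" by (simp add: pos_semidef_def)
    show "t * (mat 1 \<bullet> W) < x \<bullet> (mat 1 *v x)" for W
      using True \<open>x \<noteq> 0\<close> by simp
  qed
next
  case False
  then have "0 < t" using \<open>0 \<le> t\<close> by simp
  define T where "T = (+) (- outer x x) ` ((*\<^sub>R) t ` K)"
  have T: "M \<in> T \<longleftrightarrow> (\<exists>W\<in>K. M = t *\<^sub>R W - outer x x)" for M
    by (auto simp: T_def)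
  show thesis
  proof (rule pos_semidef_separation[of T])
    show "convex T" unfolding T_def by (intro convex_translation convex_scaling assms)
    show "compact T" unfolding T_def by (intro compact_translation compact_scaling assms)
    show "T \<noteq> {}" using \<open>K \<noteq> {}\<close> by (simp add: T_def)
    show "transpose M = M" if "M \<in> T" for M
      using that psd by (auto simp: T transpose_diff transpose_scalar transpose_outer pos_semidef_def)
    show "\<not> pos_semidef M" if "M \<in> T" for M
      using that no psd_block_schur \<open>0 < t\<close> by (auto simp: T)
  next
    fix V assume V: "pos_semidef V" "\<And>M. M \<in> T \<Longrightarrow> V \<bullet> M < 0"
    show thesis
    proof
      show "t * (V \<bullet> W) < x \<bullet> (V *v x)" if "W \<in> K" for W
      proof -
        have "V \<bullet> (t *\<^sub>R W - outer x x) < 0" using V(2) that T by blast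
        then show ?thesis by (simp add: inner_diff_right inner_outer)
      qed
    qed (rule V(1))
  qed
qed

proposition lifted_set_iff_ratio:
  fixes Q :: "real^'n^'n"
  assumes Q: "pos_def Q" and Z: "Z \<subseteq> {z. \<forall>i. z $ i \<in> {0, 1}}"
    and P: "P_polytope Q Z = solution_set m1 {1..m} \<Gamma> \<gamma> \<beta>" and "m1 \<le> m"
  shows "(x, z, t) \<in> lifted_set Q Z \<longleftrightarrow>
    z \<in> convex hull Z \<and> 0 \<le> t \<and> (\<forall>y\<in>Y_set m1 m \<Gamma>. ratio m \<Gamma> \<gamma> \<beta> x z y \<le> ereal t)"
    (is "_ \<longleftrightarrow> ?R")
proof
  assume "(x, z, t) \<in> lifted_set Q Z"
  then obtain W where zW: "(z, W) \<in> P_polytope Q Z" and block: "psd_block W x t"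
    by (auto simp: lifted_set_def)
  note t = psd_block_nonneg[OF block] and W = P_polytope_pos_semidef[OF Q zW] and sol = zW[unfolded P]
  have "z \<in> convex hull Z" unfolding fst_P_polytope[OF Z, of Q, symmetric] using zW by force
  moreover have "ratio m \<Gamma> \<gamma> \<beta> x z y \<le> ereal t" if y: "y \<in> Y_set m1 m \<Gamma>" for y
  proof -
    let ?V = "\<Sum>i=1..m. y i *\<^sub>R \<Gamma> i"
    have V: "pos_semidef ?V" and pos: "\<forall>i\<in>{1..m1}. 0 \<le> y i"
      using y by (auto simp: Y_set_def)
    have "x \<bullet> (?V *v x) \<le> t * (?V \<bullet> W)" by (rule psd_block_imp_bound[OF block W V])
    also have "\<dots> \<le> t * ((\<Sum>i=1..m. y i * \<beta> i) + (\<Sum>i=1..m. y i *\<^sub>R \<gamma> i) \<bullet> z)"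
      by (rule mult_left_mono[OF weak_duality[OF sol pos] t])
    finally show ?thesis unfolding ratio_le_iff[OF sol W y t] .
  qed
  ultimately show ?R using t by blast
next
  assume R: ?R
  define K where "K = {W. (z, W) \<in> P_polytope Q Z}"
  have psd: "\<And>W. W \<in> K \<Longrightarrow> pos_semidef W"
    using P_polytope_pos_semidef[OF Q] by (auto simp: K_def)
  have "z \<in> fst ` P_polytope Q Z" using R fst_P_polytope[OF Z] by blast
  then have "K \<noteq> {}" by (auto simp: K_def)
  have "K = snd ` (P_polytope Q Z \<inter> {z} \<times> UNIV)" by (force simp: K_def image_iff)
  moreover have "compact (snd ` (P_polytope Q Z \<inter> {z} \<times> UNIV))"
    by (intro compact_continuous_image continuous_intros compact_Int_closed compact_P_polytope
        closed_Times closed_UNIV closed_singleton)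
  ultimately have "compact K" by simp
  have "convex (P_polytope Q Z)" by (simp add: P_polytope_def)
  have "convex K"
  proof (rule convexI)
    fix W W' and a b :: real assume "W \<in> K" "W' \<in> K" and ab: "0 \<le> a" "0 \<le> b" "a + b = 1"
    then have "a *\<^sub>R (z, W) + b *\<^sub>R (z, W') \<in> P_polytope Q Z"
      by (intro convexD[OF \<open>convex (P_polytope Q Z)\<close>]) (auto simp: K_def)
    moreover have "a *\<^sub>R z + b *\<^sub>R z = z" using ab(3) by (metis scaleR_add_left scaleR_one)
    ultimately show "a *\<^sub>R W + b *\<^sub>R W' \<in> K" by (simp add: K_def)
  qed
  show "(x, z, t) \<in> lifted_set Q Z"
  proof (rule ccontr)
    assume "(x, z, t) \<notin> lifted_set Q Z"
    then have "\<And>W. W \<in> K \<Longrightarrow> \<not> psd_block W x t" by (auto simp: K_def lifted_set_def)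
    then obtain V where V: "pos_semidef V" and sep: "\<And>W. W \<in> K \<Longrightarrow> t * (V \<bullet> W) < x \<bullet> (V *v x)"
      using no_psd_block_imp_separating[OF \<open>compact K\<close> \<open>convex K\<close> \<open>K \<noteq> {}\<close> psd] R by blast
    have "continuous_on K (\<lambda>W. V \<bullet> W)" by (intro continuous_intros)
    then obtain W\<^sub>0 where W\<^sub>0: "W\<^sub>0 \<in> K" and max: "\<forall>W\<in>K. V \<bullet> W \<le> V \<bullet> W\<^sub>0"
      using continuous_attains_sup[OF \<open>compact K\<close> \<open>K \<noteq> {}\<close>] by blast
    \<comment> \<open>Scale \<open>V\<close> to meet the trace normalization in the set of multipliers.\<close>
    have tr: "0 \<le> trace V" unfolding trace_def by (intro sum_nonneg pos_semidef_diag V)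
    define a where "a = 1 / (1 + trace V)"
    have a: "0 < a" "a * trace V \<le> 1" using tr by (auto simp: a_def field_simps)
    have sol: "(z, W\<^sub>0) \<in> solution_set m1 {1..m} \<Gamma> \<gamma> \<beta>" using W\<^sub>0 by (simp add: K_def P)
    have "(a *\<^sub>R V) \<bullet> W \<le> a * (V \<bullet> W\<^sub>0)" if "(z, W) \<in> solution_set m1 {1..m} \<Gamma> \<gamma> \<beta>" for W
      using max that a(1) by (simp add: K_def P)
    then obtain y where y: "y \<in> extensional {1..m}" "\<forall>i\<in>{1..m1}. 0 \<le> y i"
      "(\<Sum>i=1..m. y i *\<^sub>R \<Gamma> i) = a *\<^sub>R V"
      "(\<Sum>i=1..m. y i * \<beta> i) + (\<Sum>i=1..m. y i *\<^sub>R \<gamma> i) \<bullet> z \<le> a * (V \<bullet> W\<^sub>0)"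
      using strong_duality[OF \<open>m1 \<le> m\<close> sol] by blast
    have "trace (a *\<^sub>R V) \<le> 1" using a(2) by (simp add: trace_def sum_distrib_left)
    then have Y: "y \<in> Y_set m1 m \<Gamma>"
      using y(1-3) pos_semidef_scaleR[OF V, of a] a(1)
      by (simp add: Y_set_def trace_sum_scaleR[symmetric])
    have "x \<bullet> ((a *\<^sub>R V) *v x) \<le> t * ((\<Sum>i=1..m. y i * \<beta> i) + (\<Sum>i=1..m. y i *\<^sub>R \<gamma> i) \<bullet> z)"
      using ratio_le_iff[OF sol psd[OF W\<^sub>0] Y, of t x] R Y unfolding y(3) by blast
    also have "\<dots> \<le> t * (a * (V \<bullet> W\<^sub>0))" using R y(4) by (intro mult_left_mono) auto
    also have "\<dots> < a * (x \<bullet> (V *v x))" using sep[OF W\<^sub>0] a(1) by (simp add: mult.left_commute)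
    finally show False by (simp add: scaleR_matrix_vector_assoc[symmetric])
  qed
qed

theorem theorem3:
  fixes Q :: "real^'n^'n" and Z :: "(real^'n) set"
    and m1 m :: nat
    and \<Gamma> :: "nat \<Rightarrow> real^'n^'n" and \<gamma> :: "nat \<Rightarrow> real^'n" and \<beta> :: "nat \<Rightarrow> real"
    and x z :: "real^'n" and t :: real
  assumes "pos_def Q"
    and "Z \<subseteq> {z. \<forall>i. z $ i \<in> {0, 1}}"
    and "minimal_description (P_polytope Q Z) m1 m \<Gamma> \<gamma> \<beta>"
  shows "((x, z, t) \<in> closure (convex hull (X_set Q Z)) \<longleftrightarrow>
            z \<in> convex hull Z \<and> 0 \<le> t \<and>
            (\<forall>y\<in>Y_set m1 m \<Gamma>. ereal t \<ge> ratio m \<Gamma> \<gamma> \<beta> x z y))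
       \<and> ((x, z, t) \<in> closure (convex hull (X_set Q Z)) \<longleftrightarrow>
            z \<in> convex hull Z \<and> 0 \<le> t \<and>
            ereal t \<ge> (SUP y\<in>Y_set m1 m \<Gamma>. ratio m \<Gamma> \<gamma> \<beta> x z y))"
proof -
  have P: "P_polytope Q Z = solution_set m1 {1..m} \<Gamma> \<gamma> \<beta>" and "m1 \<le> m"
    using assms(3) by (simp_all add: minimal_description_def)
  show ?thesis
    unfolding closure_convex_hull_X_set[OF assms(1,2)]
      lifted_set_iff_ratio[OF assms(1,2) P \<open>m1 \<le> m\<close>] SUP_le_iff
    by blast
qed

end
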